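(* Let $p\ge1$ be an integer. The coefficients of every mapping $F\in\mathcal{HS}_p$ satisfy the inequalities $$\sum_{k=1}^{p}\big(|a_{k,j}|+|b_{k,j}|\big)\le\frac1j$$ for all $j=2,3,\ldots$. These inequalities are sharp, i.e. for each $j\ge2$ there is a mapping $F\in\mathcal{HS}_p$ for which equality holds.
   Context: $\mathbb{D}=\{z\in\mathbb{C}:|z|<1\}$. For an integer $p\ge1$, $\mathcal{H}_p$ is the set of polyharmonic mappings $F$ in $\mathbb{D}$ of the form $$F(z)=\sum_{k=1}^{p}|z|^{2(k-1)}\big(h_k(z)+\overline{g_k(z)}\big)=\sum_{k=1}^{p}|z|^{2(k-1)}\sum_{j=1}^{\infty}\big(a_{k,j}z^j+\overline{b_{k,j}}\,\overline{z^j}\big),$$ with $h_k(z)=\sum_{j\ge1}a_{k,j}z^j$, $g_k(z)=\sum_{j\ge1}b_{k,j}z^j$ analytic in $\mathbb{D}$, $a_{1,1}=1$, $|b_{1,1}|<1$; the $a_{k,j},b_{k,j}$ are the coefficients of $F$. $\mathcal{HS}_p$ is the class of $F\in\mathcal{H}_p$ satisfying $$\sum_{k=1}^{p}\sum_{j=2}^{\infty}\big(2(k-1)+j\big)\big(|a_{k,j}|+|b_{k,j}|\big)\le 1-|b_{1,1}|-\sum_{k=2}^{p}(2k-1)\big(|a_{k,1}|+|b_{k,1}|\big)$$ and $$0\le |b_{1,1}|+\sum_{k=2}^{p}(2k-1)\big(|a_{k,1}|+|b_{k,1}|\big)<1.$$ *)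

theory Defs
  imports "HOL-Analysis.Analysis"
begin

text \<open>
  Only the values of \<open>F\<close> on the unit disc and the entries \<open>a k j\<close>, \<open>b k j\<close> with
  \<open>1 \<le> k \<le> p\<close> and \<open>1 \<le> j\<close> matter. These entries are determined by \<open>F\<close>: for
  \<open>z = r e\<^sup>i\<^sup>t\<close> the Fourier coefficients of \<open>F\<close> in \<open>t\<close> are polynomials in \<open>r\<close>
  whose coefficients are the \<open>a k j\<close> and \<open>cnj (b k j)\<close>.
\<close>

definition polyharmonic_coeffs ::
  "nat \<Rightarrow> (complex \<Rightarrow> complex) \<Rightarrow> (nat \<Rightarrow> nat \<Rightarrow> complex) \<Rightarrow> (nat \<Rightarrow> nat \<Rightarrow> complex) \<Rightarrow> bool" where
  "polyharmonic_coeffs p F a b \<longleftrightarrow>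
     a 1 1 = 1 \<and> cmod (b 1 1) < 1 \<and>
     (\<exists>h g :: nat \<Rightarrow> complex \<Rightarrow> complex.
        (\<forall>k\<in>{1..p}.
           h k analytic_on ball 0 1 \<and> g k analytic_on ball 0 1 \<and>
           (\<forall>z\<in>ball 0 1.
              ((\<lambda>j. a k j * z ^ j) has_sum h k z) {1..} \<and>
              ((\<lambda>j. b k j * z ^ j) has_sum g k z) {1..})) \<and>
        (\<forall>z\<in>ball 0 1.
           F z = (\<Sum>k=1..p. of_real (cmod z ^ (2 * (k - 1))) * (h k z + cnj (g k z)))))"

definition polyharmonic_H :: "nat \<Rightarrow> (complex \<Rightarrow> complex) set" where
  "polyharmonic_H p = {F. \<exists>a b. polyharmonic_coeffs p F a b}"

text \<open>
  The summability clause expresses that the infinite series in the inequality converge;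
  a divergent \<open>infsum\<close> would be \<open>0\<close>.
\<close>

definition polyharmonic_HS :: "nat \<Rightarrow> (complex \<Rightarrow> complex) set" where
  "polyharmonic_HS p = {F \<in> polyharmonic_H p. \<exists>a b. polyharmonic_coeffs p F a b \<and>
     (\<forall>k\<in>{1..p}. (\<lambda>j. real (2 * (k - 1) + j) * (cmod (a k j) + cmod (b k j))) summable_on {2..}) \<and>
     (\<Sum>k=1..p. \<Sum>\<^sub>\<infinity>j\<in>{2..}. real (2 * (k - 1) + j) * (cmod (a k j) + cmod (b k j)))
       \<le> 1 - cmod (b 1 1) - (\<Sum>k=2..p. real (2 * k - 1) * (cmod (a k 1) + cmod (b k 1))) \<and>
     0 \<le> cmod (b 1 1) + (\<Sum>k=2..p. real (2 * k - 1) * (cmod (a k 1) + cmod (b k 1))) \<and>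
     cmod (b 1 1) + (\<Sum>k=2..p. real (2 * k - 1) * (cmod (a k 1) + cmod (b k 1))) < 1}"

end

theory Submission
  imports Defs "HOL-Complex_Analysis.Complex_Analysis"
begin

text \<open>
  The bound is a comparison of terms, \<open>j \<le> 2 (k - 1) + j\<close>, once it is known that a map has only one
  system of coefficients. For uniqueness, suppose that \<open>F = 0\<close>. On a circle \<open>|z| = r\<close> the factors
  \<open>|z| ^ (2 * (k - 1))\<close> are constants, so \<open>u + cnj v = 0\<close> there for two holomorphic functions \<open>u\<close>, \<open>v\<close> that
  vanish at \<open>0\<close>. Then \<open>u + v\<close> is purely imaginary and \<open>u - v\<close> is real on the circle, so both vanish in
  the disc by the maximum principle. Hence the Taylor coefficients of \<open>u\<close> and \<open>v\<close>, which are
  polynomials in \<open>r\<^sup>2\<close>, are zero for every \<open>r\<close> in \<open>(0, 1)\<close>. The extremal map is \<open>z + z\<^sup>j / j\<close>.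
\<close>

text \<open>The maximum principle for \<open>f\<close> and \<open>- f\<close> gives
  \<open>Re f = 0\<close> in the whole disc. A nonconstant \<open>f\<close> would be an open map,
  which cannot send the disc into the imaginary axis; so \<open>f\<close> is constant, with value
  \<open>f 0 = 0\<close>.\<close>

lemma holomorphic_zero_if_Re_zero_on_sphere:
  assumes hol: "f holomorphic_on ball 0 R" and r: "0 < r" "r < R"
    and Re0: "\<And>z. z \<in> sphere 0 r \<Longrightarrow> Re (f z) = 0" and f0: "f 0 = 0"
    and z: "z \<in> ball 0 r"
  shows "f z = 0"
proof -
  have sub: "ball 0 r \<subseteq> ball 0 R" "cball 0 r \<subseteq> ball (0::complex) R"
    using r by auto
  have holr: "f holomorphic_on ball 0 r" and contr: "continuous_on (cball 0 r) f"
    using hol sub holomorphic_on_subset holomorphic_on_imp_continuous_on by blast+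
  have frontier: "interior (ball 0 r) = ball (0::complex) r" "closure (ball 0 r) = cball (0::complex) r"
    "frontier (ball 0 r) = sphere (0::complex) r"
    using r by auto
  have Re_le: "Re (g w) \<le> 0"
    if "g holomorphic_on ball 0 r" "continuous_on (cball 0 r) g" "\<And>z. z \<in> sphere 0 r \<Longrightarrow> Re (g z) = 0"
      and "w \<in> ball 0 r" for g w
    by (rule maximum_real_frontier[of g "ball 0 r"]) (simp_all only: frontier that bounded_ball order_refl)
  have Re_ball: "Re (f w) = 0" if "w \<in> ball 0 r" for w
  proof -
    have "Re (f w) \<le> 0"
      by (rule Re_le[OF holr contr Re0 that])
    moreover have "Re (- f w) \<le> 0"
      by (rule Re_le[OF holomorphic_on_minus[OF holr] continuous_on_minus[OF contr] _ that]) (simp add: Re0)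
    ultimately show ?thesis
      by simp
  qed
  have "f constant_on ball 0 r"
  proof (rule ccontr)
    assume "\<not> f constant_on ball 0 r"
    with holr have "open (f ` ball 0 r)"
      by (intro open_mapping_thm[of f "ball 0 r"]) auto
    moreover have "0 \<in> f ` ball 0 r"
      using r f0 by (force intro!: image_eqI[of _ _ 0])
    ultimately obtain e where e: "e > 0" "ball 0 e \<subseteq> f ` ball 0 r"
      using open_contains_ball by blast
    \<comment> \<open>A ball about \<open>0\<close> contains a positive real number, which is off
      the imaginary axis.\<close>
    then have "of_real (e / 2) \<in> f ` ball 0 r"
      by (auto simp: subset_iff)
    then show False
      using Re_ball e by (force simp: complex_eq_iff)
  qed
  then show ?thesis
    using z r f0 unfolding constant_on_def by (metis centre_in_ball)
qed

text \<open>A nonzero coefficient would make the zero at the origin isolated, which is absurd for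
  the zero function.\<close>

lemma power_series_coeff_zero:
  fixes c :: "nat \<Rightarrow> complex"
  assumes "r > 0" and hs: "\<And>z. z \<in> ball 0 r \<Longrightarrow> ((\<lambda>j. c j * z ^ j) has_sum 0) {1..}" and "j \<ge> 1"
  shows "c j = 0"
proof (rule ccontr)
  assume cj: "c j \<noteq> 0"
  \<comment> \<open>The sums start at index \<open>1\<close>; a zero constant term turns them into
    full power series.\<close>
  define c' where "c' n = (if n = 0 then 0 else c n)" for n
  have "(\<lambda>n. c' n * (z - 0) ^ n) sums 0" if "norm (z - 0) < r" for z
  proof (rule has_sum_imp_sums)
    have "((\<lambda>n. c' n * (z - 0) ^ n) has_sum 0) UNIV \<longleftrightarrow> ((\<lambda>j. c j * z ^ j) has_sum 0) {1..}"
      by (rule has_sum_cong_neutral) (auto simp: c'_def)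
    with hs that show "((\<lambda>n. c' n * (z - 0) ^ n) has_sum 0) UNIV"
      by simp
  qed
  moreover have "c' j \<noteq> 0" "j > 0"
    using cj \<open>j \<ge> 1\<close> by (auto simp: c'_def)
  ultimately obtain s where s: "0 < s" "\<And>z::complex. z \<in> cball 0 s - {0} \<Longrightarrow> (0::complex) \<noteq> 0"
    using powser_0_nonzero[OF \<open>r > 0\<close>, where \<xi> = 0 and f = "\<lambda>_. 0" and a = c' and m = j] by blast
  show False
    using s(2)[of "of_real s"] s(1) by auto
qed

lemma harmonic_coeffs_zero_if_zero_on_sphere:
  fixes c d :: "nat \<Rightarrow> complex"
  assumes hol: "u holomorphic_on ball 0 R" "v holomorphic_on ball 0 R"
    and u: "\<And>z. z \<in> ball 0 R \<Longrightarrow> ((\<lambda>j. c j * z ^ j) has_sum u z) {1..}"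
    and v: "\<And>z. z \<in> ball 0 R \<Longrightarrow> ((\<lambda>j. d j * z ^ j) has_sum v z) {1..}"
    and r: "0 < r" "r < R"
    and zero: "\<And>z. z \<in> sphere 0 r \<Longrightarrow> u z + cnj (v z) = 0"
    and j: "j \<ge> 1"
  shows "c j = 0" "d j = 0"
proof -
  \<comment> \<open>Without constant terms both functions vanish at the origin, which excludes
    nonzero imaginary constants below.\<close>
  have "((\<lambda>j. c j * 0 ^ j) has_sum 0) {1..}" "((\<lambda>j. d j * 0 ^ j) has_sum 0) {1..}"
    by (auto intro!: has_sum_0)
  then have at0: "u 0 = 0" "v 0 = 0"
    using u[of 0] v[of 0] r has_sum_unique by force+
  have sphere: "u z = - cnj (v z)" if "z \<in> sphere 0 r" for z
    using zero[OF that] by (simp add: eq_neg_iff_add_eq_0)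
  have plus: "u z + v z = 0" if "z \<in> ball 0 r" for z
    by (rule holomorphic_zero_if_Re_zero_on_sphere[of "\<lambda>z. u z + v z", OF _ r _ _ that])
      (auto intro!: holomorphic_intros hol simp: at0 sphere)
  \<comment> \<open>On the circle \<open>u - v = - (v + cnj v)\<close> is real; the factor
    \<open>\<i>\<close> makes the real part vanish.\<close>
  have minus: "\<i> * (u z - v z) = 0" if "z \<in> ball 0 r" for z
    by (rule holomorphic_zero_if_Re_zero_on_sphere[of "\<lambda>z. \<i> * (u z - v z)", OF _ r _ _ that])
      (auto intro!: holomorphic_intros hol simp: at0 sphere)
  have uv0: "u z = 0" "v z = 0" if "z \<in> ball 0 r" for z
    using plus[OF that] minus[OF that] by auto
  have sub: "z \<in> ball 0 R" if "z \<in> ball 0 r" for z :: complex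
    using that r by simp
  show "c j = 0"
    using power_series_coeff_zero[OF r(1) _ j, of c] u[OF sub] uv0(1) by metis
  show "d j = 0"
    using power_series_coeff_zero[OF r(1) _ j, of d] v[OF sub] uv0(2) by metis
qed

text \<open>In the variable \<open>r\<^sup>2\<close> the sum is a polynomial of degree at most
  \<open>p - 1\<close> with infinitely many zeros.\<close>

lemma even_polynomial_coeffs_zero:
  fixes C :: "nat \<Rightarrow> complex"
  assumes zero: "\<And>r. 0 < r \<Longrightarrow> r < 1 \<Longrightarrow> (\<Sum>k=1..p. of_real (r ^ (2 * (k - 1))) * C k) = 0"
    and k: "k \<in> {1..p}"
  shows "C k = 0"
proof -
  have eq: "(\<Sum>i\<le>p - 1. C (Suc i) * z ^ i) = 0" if z: "z \<in> (\<lambda>r. of_real (r\<^sup>2)) ` {0<..<1}" for z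
  proof -
    obtain r where r: "0 < r" "r < 1" "z = of_real (r\<^sup>2)"
      using z by auto
    \<comment> \<open>The index shift needs \<open>p \<ge> 1\<close>, which \<open>k\<close>
      supplies; for \<open>p = 0\<close> the left sum would still have one term.\<close>
    have "(\<Sum>i\<le>p - 1. C (Suc i) * z ^ i) = (\<Sum>k=1..p. of_real (r ^ (2 * (k - 1))) * C k)"
      by (rule sum.reindex_bij_witness[of _ "\<lambda>k. k - 1" Suc])
        (use k r(3) in \<open>auto simp: power_mult\<close>)
    with zero r show ?thesis
      by simp
  qed
  have "inj_on (\<lambda>r. of_real (r\<^sup>2) :: complex) {0<..<1}"
    by (auto simp: inj_on_def simp flip: of_real_power)
  then have "infinite ((\<lambda>r. of_real (r\<^sup>2) :: complex) ` {0<..<1})"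
    by (simp add: finite_image_iff)
  moreover have "(\<lambda>r. of_real (r\<^sup>2)) ` {0<..<1} \<subseteq> {z. (\<Sum>i\<le>p - 1. C (Suc i) * z ^ i) = 0}"
    using eq by (intro subsetI CollectI)
  ultimately have "infinite {z. (\<Sum>i\<le>p - 1. C (Suc i) * z ^ i) = 0}"
    using finite_subset[of _ "{z. (\<Sum>i\<le>p - 1. C (Suc i) * z ^ i) = 0}"] by metis
  then have "C (Suc i) = 0" if "i \<le> p - 1" for i
    using polyfun_rootbound_finite[where c = "\<lambda>i. C (Suc i)" and n = "p - 1"] that by blast
  from this[of "k - 1"] k show ?thesis
    by auto
qed

text \<open>With \<open>x k\<close> a fixed power of the radius, this yields the Taylor coefficients
  of the functions \<open>u\<close> and \<open>v\<close> built from two representations of one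
  map.\<close>

lemma has_sum_linear_combination_diff:
  fixes f f' :: "'k \<Rightarrow> 'j \<Rightarrow> complex"
  assumes "\<And>k. k \<in> K \<Longrightarrow> ((\<lambda>j. f k j * w j) has_sum s k) A"
    and "\<And>k. k \<in> K \<Longrightarrow> ((\<lambda>j. f' k j * w j) has_sum s' k) A"
  shows "((\<lambda>j. (\<Sum>k\<in>K. x k * (f k j - f' k j)) * w j) has_sum (\<Sum>k\<in>K. x k * (s k - s' k))) A"
proof -
  have term_diff: "((\<lambda>j. x k * (f k j - f' k j) * w j) has_sum (x k * (s k - s' k))) A" if "k \<in> K" for k
    using has_sum_cmult_right[OF has_sum_add[OF assms(1)[OF that] has_sum_uminusI[OF assms(2)[OF that]]], of "x k"]
    by (simp add: algebra_simps)
  \<comment> \<open>The induction runs over subsets of \<open>K\<close> because convergence is known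
    only for indices in \<open>K\<close>.\<close>
  have "((\<lambda>j. \<Sum>k\<in>L. x k * (f k j - f' k j) * w j) has_sum (\<Sum>k\<in>L. x k * (s k - s' k))) A"
    if "L \<subseteq> K" for L
    using that by (induction L rule: infinite_finite_induct) (auto intro!: has_sum_add term_diff)
  then show ?thesis
    by (simp add: sum_distrib_right)
qed

lemma polyharmonic_coeffs_unique:
  assumes ab: "polyharmonic_coeffs p F a b" and ab': "polyharmonic_coeffs p F a' b'"
    and k: "k \<in> {1..p}" and j: "j \<ge> 1"
  shows "a k j = a' k j" "b k j = b' k j"
proof -
  obtain h g where
    hg: "\<And>k. k \<in> {1..p} \<Longrightarrow> h k analytic_on ball 0 1" "\<And>k. k \<in> {1..p} \<Longrightarrow> g k analytic_on ball 0 1"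
    and h: "\<And>k z. k \<in> {1..p} \<Longrightarrow> z \<in> ball 0 1 \<Longrightarrow> ((\<lambda>j. a k j * z ^ j) has_sum h k z) {1..}"
    and g: "\<And>k z. k \<in> {1..p} \<Longrightarrow> z \<in> ball 0 1 \<Longrightarrow> ((\<lambda>j. b k j * z ^ j) has_sum g k z) {1..}"
    and F: "\<And>z. z \<in> ball 0 1 \<Longrightarrow>
      F z = (\<Sum>k=1..p. of_real (cmod z ^ (2 * (k - 1))) * (h k z + cnj (g k z)))"
    using ab unfolding polyharmonic_coeffs_def by blast
  obtain h' g' where
    hg': "\<And>k. k \<in> {1..p} \<Longrightarrow> h' k analytic_on ball 0 1" "\<And>k. k \<in> {1..p} \<Longrightarrow> g' k analytic_on ball 0 1"
    and h': "\<And>k z. k \<in> {1..p} \<Longrightarrow> z \<in> ball 0 1 \<Longrightarrow> ((\<lambda>j. a' k j * z ^ j) has_sum h' k z) {1..}"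
    and g': "\<And>k z. k \<in> {1..p} \<Longrightarrow> z \<in> ball 0 1 \<Longrightarrow> ((\<lambda>j. b' k j * z ^ j) has_sum g' k z) {1..}"
    and F': "\<And>z. z \<in> ball 0 1 \<Longrightarrow>
      F z = (\<Sum>k=1..p. of_real (cmod z ^ (2 * (k - 1))) * (h' k z + cnj (g' k z)))"
    using ab' unfolding polyharmonic_coeffs_def by blast
  have hol: "h k holomorphic_on ball 0 1" "g k holomorphic_on ball 0 1"
    "h' k holomorphic_on ball 0 1" "g' k holomorphic_on ball 0 1" if "k \<in> {1..p}" for k
    using hg hg' that analytic_imp_holomorphic by blast+
  have sums0: "(\<Sum>k=1..p. of_real (r ^ (2 * (k - 1))) * (a k j - a' k j)) = 0"
    "(\<Sum>k=1..p. of_real (r ^ (2 * (k - 1))) * (b k j - b' k j)) = 0"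
    if r: "0 < r" "r < 1" for r
  proof -
    \<comment> \<open>The radius \<open>r\<close> stays fixed while \<open>z\<close> ranges over the
      whole disc, so \<open>u\<close> and \<open>v\<close> are holomorphic; they are tied to
      \<open>F\<close> only on the circle of radius \<open>r\<close>.\<close>
    define x :: "nat \<Rightarrow> complex" where "x k = of_real (r ^ (2 * (k - 1)))" for k
    define u where "u z = (\<Sum>k=1..p. x k * (h k z - h' k z))" for z
    define v where "v z = (\<Sum>k=1..p. x k * (g k z - g' k z))" for z
    have holuv: "u holomorphic_on ball 0 1" "v holomorphic_on ball 0 1"
      unfolding u_def v_def by (auto intro!: holomorphic_intros hol)
    have u: "((\<lambda>j. (\<Sum>k=1..p. x k * (a k j - a' k j)) * z ^ j) has_sum u z) {1..}"
      and v: "((\<lambda>j. (\<Sum>k=1..p. x k * (b k j - b' k j)) * z ^ j) has_sum v z) {1..}"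
      if "z \<in> ball 0 1" for z
      unfolding u_def v_def
      using h[OF _ that] h'[OF _ that] g[OF _ that] g'[OF _ that]
      by (auto intro!: has_sum_linear_combination_diff)
    have zero: "u z + cnj (v z) = 0" if "z \<in> sphere 0 r" for z
    proof -
      have z: "z \<in> ball 0 1" "cmod z = r"
        using that r by auto
      have "u z + cnj (v z) = (\<Sum>k=1..p. x k * (h k z + cnj (g k z))) - (\<Sum>k=1..p. x k * (h' k z + cnj (g' k z)))"
        unfolding u_def v_def
        by (simp add: x_def algebra_simps sum.distrib sum_subtractf)
      then show ?thesis
        using F[OF z(1)] F'[OF z(1)] by (simp add: x_def z(2))
    qed
    show "(\<Sum>k=1..p. of_real (r ^ (2 * (k - 1))) * (a k j - a' k j)) = 0"
      "(\<Sum>k=1..p. of_real (r ^ (2 * (k - 1))) * (b k j - b' k j)) = 0"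
      using harmonic_coeffs_zero_if_zero_on_sphere[OF holuv u v r zero j] by (auto simp: x_def)
  qed
  \<comment> \<open>For fixed \<open>j\<close> the relation holds for every \<open>r\<close> in
    \<open>(0, 1)\<close>, so the contributions of different \<open>k\<close> separate.\<close>
  show "a k j = a' k j"
    using even_polynomial_coeffs_zero[where p = p and C = "\<lambda>k. a k j - a' k j", OF sums0(1) k] by simp
  show "b k j = b' k j"
    using even_polynomial_coeffs_zero[where p = p and C = "\<lambda>k. b k j - b' k j", OF sums0(2) k] by simp
qed

lemma polyharmonic_HS_coeff_bound:
  assumes F: "F \<in> polyharmonic_HS p" and ab: "polyharmonic_coeffs p F a b" and j: "j \<ge> 2"
  shows "(\<Sum>k=1..p. cmod (a k j) + cmod (b k j)) \<le> 1 / real j"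
proof -
  obtain a' b' where ab': "polyharmonic_coeffs p F a' b'"
    and summ: "\<And>k. k \<in> {1..p} \<Longrightarrow>
      (\<lambda>j. real (2 * (k - 1) + j) * (cmod (a' k j) + cmod (b' k j))) summable_on {2..}"
    and le: "(\<Sum>k=1..p. \<Sum>\<^sub>\<infinity>j\<in>{2..}. real (2 * (k - 1) + j) * (cmod (a' k j) + cmod (b' k j)))
       \<le> 1 - cmod (b' 1 1) - (\<Sum>k=2..p. real (2 * k - 1) * (cmod (a' k 1) + cmod (b' k 1)))"
    using F unfolding polyharmonic_HS_def by blast
  \<comment> \<open>Membership in the class provides its own coefficients \<open>a'\<close>,
    \<open>b'\<close>; uniqueness transfers their inequality to \<open>a\<close>,
    \<open>b\<close>.\<close>
  have "real j * (\<Sum>k=1..p. cmod (a k j) + cmod (b k j)) =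
      (\<Sum>k=1..p. real j * (cmod (a' k j) + cmod (b' k j)))"
    unfolding sum_distrib_left
    using polyharmonic_coeffs_unique[OF ab ab'] j by (intro sum.cong) auto
  also have "\<dots> \<le> (\<Sum>k=1..p. \<Sum>\<^sub>\<infinity>j\<in>{2..}. real (2 * (k - 1) + j) * (cmod (a' k j) + cmod (b' k j)))"
  proof (rule sum_mono)
    fix k assume k: "k \<in> {1..p}"
    have "real j * (cmod (a' k j) + cmod (b' k j)) \<le> real (2 * (k - 1) + j) * (cmod (a' k j) + cmod (b' k j))"
      by (intro mult_right_mono) auto
    \<comment> \<open>One term of a convergent series of nonnegative terms is at most its
      sum.\<close>
    also have "\<dots> \<le> (\<Sum>\<^sub>\<infinity>j\<in>{2..}. real (2 * (k - 1) + j) * (cmod (a' k j) + cmod (b' k j)))"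
      using finite_sum_le_infsum[OF summ[OF k], of "{j}"] j by simp
    finally show "real j * (cmod (a' k j) + cmod (b' k j)) \<le> \<dots>" .
  qed
  also have "\<dots> \<le> 1"
  proof -
    have "0 \<le> (\<Sum>k=2..p. real (2 * k - 1) * (cmod (a' k 1) + cmod (b' k 1)))"
      by (intro sum_nonneg) auto
    with le norm_ge_zero[of "b' 1 1"] show ?thesis
      by linarith
  qed
  finally show ?thesis
    using j by (simp add: field_simps)
qed

text \<open>The whole allowance \<open>1\<close> goes into one coefficient with
  \<open>k = 1\<close>, where the weight \<open>2 * (k - 1) + j\<close> is exactly \<open>j\<close>;
  the value \<open>1 / j\<close> then turns the inequality of the class into an equality.\<close>

lemma polyharmonic_HS_coeff_bound_sharp:
  assumes p: "p \<ge> 1" and j: "j \<ge> 2"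
  shows "\<exists>F\<in>polyharmonic_HS p. \<exists>a b. polyharmonic_coeffs p F a b \<and>
    (\<Sum>k=1..p. cmod (a k j) + cmod (b k j)) = 1 / real j"
proof -
  define F :: "complex \<Rightarrow> complex" where "F z = z + z ^ j / of_nat j" for z
  define a :: "nat \<Rightarrow> nat \<Rightarrow> complex" where
    "a k i = (if k = 1 then if i = 1 then 1 else if i = j then 1 / of_nat j else 0 else 0)" for k i
  define b :: "nat \<Rightarrow> nat \<Rightarrow> complex" where "b k i = 0" for k i
  define h :: "nat \<Rightarrow> complex \<Rightarrow> complex" where "h k z = (if k = 1 then F z else 0)" for k z
  have split: "{1..p} = insert 1 {2..p}"
    using p by auto
  have an: "h k analytic_on ball 0 1" for k
    unfolding h_def F_def using j by (cases "k = 1") (auto intro!: analytic_intros)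
  have hs: "((\<lambda>i. a k i * z ^ i) has_sum h k z) {1..}" for k z
    by (rule has_sum_finite_neutralI[of "{1, j}"]) (use j in \<open>auto simp: a_def h_def F_def\<close>)
  have F_eq: "F z = (\<Sum>k=1..p. of_real (cmod z ^ (2 * (k - 1))) * (h k z + cnj 0))" for z
    unfolding split by (simp add: h_def)
  have co: "polyharmonic_coeffs p F a b"
    unfolding polyharmonic_coeffs_def
    by (intro conjI exI[of _ h] exI[of _ "\<lambda>_ _. 0"] ballI an hs F_eq)
      (auto simp: a_def b_def)
  have term_sum: "((\<lambda>i. real (2 * (k - 1) + i) * (cmod (a k i) + cmod (b k i)))
      has_sum (if k = 1 then 1 else 0)) {2..}" for k
    by (rule has_sum_finite_neutralI[of "{j}"]) (use j in \<open>auto simp: a_def b_def norm_divide\<close>)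
  have tail0: "(\<Sum>k=2..p. real (2 * k - 1) * (cmod (a k 1) + cmod (b k 1))) = 0"
    by (auto simp: a_def b_def)
  have "(\<Sum>k=1..p. \<Sum>\<^sub>\<infinity>i\<in>{2..}. real (2 * (k - 1) + i) * (cmod (a k i) + cmod (b k i))) = 1"
    unfolding infsumI[OF term_sum] split by simp
  then have "F \<in> polyharmonic_HS p"
    unfolding polyharmonic_HS_def polyharmonic_H_def mem_Collect_eq
    using co tail0 has_sum_imp_summable[OF term_sum]
    by (intro conjI exI[of _ a] exI[of _ b]) (simp_all only: b_def norm_zero, simp_all)
  moreover have "(\<Sum>k=1..p. cmod (a k j) + cmod (b k j)) = 1 / real j"
    unfolding split using j by (simp add: a_def b_def norm_divide)
  ultimately show ?thesis
    using co by blast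
qed

theorem theorem5:
  fixes p :: nat
  assumes "p \<ge> 1"
  shows "(\<forall>F\<in>polyharmonic_HS p. \<forall>a b. polyharmonic_coeffs p F a b \<longrightarrow>
            (\<forall>j\<ge>2. (\<Sum>k=1..p. cmod (a k j) + cmod (b k j)) \<le> 1 / real j)) \<and>
         (\<forall>j\<ge>2. \<exists>F\<in>polyharmonic_HS p. \<exists>a b. polyharmonic_coeffs p F a b \<and>
            (\<Sum>k=1..p. cmod (a k j) + cmod (b k j)) = 1 / real j)"
  using polyharmonic_HS_coeff_bound polyharmonic_HS_coeff_bound_sharp[OF assms] by blast

end
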